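(* Let $d \geq 3$, $r \geq 1280 (d-1) \log(d)$ and $\epsilon = \frac{1}{320 (d-1)}$. For every algorithm playing the cutting-planes game in $B(x_{\mathrm{ref}},r)\subset\mathbb{H}^d$, there is an $x^* \in B(x_{\mathrm{ref}}, r)$ and a sequence of oracle responses $(g_k)_{k \geq 0}$ such that the algorithm needs at least $T = \frac{1}{32}(d-1) r$ queries to find a point $x_k$ such that $\mathrm{dist}(x^*, S_k) \leq \epsilon r$ (or equivalently $S_k \cap B(x^*, \epsilon r) \neq \emptyset$), where $S_k = \exp_{x_k}(\{v \in \mathrm{T}_{x_k} \mathbb{H}^d : \langle v, g_k \rangle = 0\})$. That is, $\mathrm{dist}(x^*,S_k)>\epsilon r$ for every integer $0\le k<T$.
   Context: $\mathbb{H}^d$ is $d$-dimensional hyperbolic space of constant sectional curvature $-1$ with a fixed reference point $x_{\mathrm{ref}}$; $\mathrm{dist}$ is Riemannian distance, $B(x,r)=\{y:\mathrm{dist}(x,y)\le r\}$, and $\log_x$ is the inverse of the exponential map $\exp_x$. Cutting-planes game: the algorithm is given the ball $B(x_{\mathrm{ref}},r)$, which contains an unknown point $x^*$. At each step $k=0,1,2,\ldots$ the (deterministic) algorithm queries a point $x_k\in\mathbb{H}^d$, chosen as a function of the previous queries and oracle responses $(x_\ell,g_\ell)_{\ell<k}$, and receives from the oracle a unit vector $g_k\in\mathrm{T}_{x_k}\mathbb{H}^d$ satisfying $\langle\log_{x_k}(x^* ),g_k\rangle\le0$. The algorithm's goal is to find $x_k$ with $\mathrm{dist}(x^*,S_k)\le\epsilon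 r$, where $S_k=\exp_{x_k}(\{v\in\mathrm{T}_{x_k}\mathbb{H}^d:\langle v,g_k\rangle=0\})$. The oracle responses referred to in the statement are required to satisfy these rules for the point $x^*$. *)

theory Defs
  imports "HOL-Analysis.Analysis"
begin

section \<open>Hyperbolic space\<close>

text \<open>
  Hyperbolic space of dimension \<open>DIM('a)\<close> and constant sectional curvature \<open>-1\<close> is realised by the
  hyperboloid model: the upper sheet of the unit hyperboloid in \<open>real \<times> 'a\<close>, whose Riemannian metric
  is the restriction of the Lorentzian form \<open>mink\<close> to the tangent spaces. A tangent vector at \<open>x\<close> is
  an element of \<open>real \<times> 'a\<close> that is \<open>mink\<close>-orthogonal to \<open>x\<close>.
\<close>

definition mink :: "real \<times> 'a::euclidean_space \<Rightarrow> real \<times> 'a \<Rightarrow> real" where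
  "mink u v = snd u \<bullet> snd v - fst u * fst v"

definition hyperboloid :: "(real \<times> 'a::euclidean_space) set" where
  "hyperboloid = {x. mink x x = -1 \<and> fst x > 0}"

definition tangent :: "real \<times> 'a::euclidean_space \<Rightarrow> (real \<times> 'a) set" where
  "tangent x = {v. mink x v = 0}"

definition hnorm :: "real \<times> 'a::euclidean_space \<Rightarrow> real" where
  "hnorm v = sqrt (mink v v)"

text \<open>
  Riemannian distance: the infimum of the lengths of the \<open>C\<^sup>1\<close> curves from \<open>x\<close> to \<open>y\<close>. The closed form
  is \<open>hdist_eq_arcosh\<close> below.
\<close>

definition curve_lengths ::
    "real \<times> 'a::euclidean_space \<Rightarrow> real \<times> 'a \<Rightarrow> real set" where
  "curve_lengths x y =
     {integral {0..1} (\<lambda>t. hnorm (\<gamma>' t)) | \<gamma> \<gamma>'.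
        \<gamma> ` {0..1} \<subseteq> hyperboloid \<and> \<gamma> 0 = x \<and> \<gamma> 1 = y \<and>
        (\<forall>t\<in>{0..1}. (\<gamma> has_vector_derivative \<gamma>' t) (at t within {0..1})) \<and>
        continuous_on {0..1} \<gamma>'}"

definition hdist :: "real \<times> 'a::euclidean_space \<Rightarrow> real \<times> 'a \<Rightarrow> real" where
  "hdist x y = Inf (curve_lengths x y)"

definition hball :: "real \<times> 'a::euclidean_space \<Rightarrow> real \<Rightarrow> (real \<times> 'a) set" where
  "hball x r = {y \<in> hyperboloid. hdist x y \<le> r}"

definition hdist_set :: "real \<times> 'a::euclidean_space \<Rightarrow> (real \<times> 'a) set \<Rightarrow> real" where
  "hdist_set x S = (INF y\<in>S. hdist x y)"

text \<open>
  The exponential map. For \<open>v = 0\<close> the formula yields \<open>x\<close>. That \<open>t \<mapsto> hexp x (t v)\<close> is the geodesic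
  with initial velocity \<open>v\<close> is shown in \<open>hexp_geodesic\<close> below; that \<open>hexp x\<close> is a bijection from the
  tangent space onto the hyperboloid is shown in \<open>bij_betw_hexp\<close>, so \<open>hlog x\<close> is its inverse.
\<close>

definition hexp :: "real \<times> 'a::euclidean_space \<Rightarrow> real \<times> 'a \<Rightarrow> real \<times> 'a" where
  "hexp x v = cosh (hnorm v) *\<^sub>R x + (sinh (hnorm v) / hnorm v) *\<^sub>R v"

definition hlog :: "real \<times> 'a::euclidean_space \<Rightarrow> real \<times> 'a \<Rightarrow> real \<times> 'a" where
  "hlog x = the_inv_into (tangent x) (hexp x)"

text \<open>The totally geodesic hypersurface through \<open>x\<close> orthogonal to \<open>g\<close>.\<close>

definition hhyperplane :: "real \<times> 'a::euclidean_space \<Rightarrow> real \<times> 'a \<Rightarrow> (real \<times> 'a) set" where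
  "hhyperplane x g = hexp x ` {v \<in> tangent x. mink v g = 0}"


section \<open>The cutting-planes game\<close>

text \<open>
  A deterministic algorithm maps the list of previous queries and responses (oldest first) to the
  next query.
\<close>

type_synonym 'a algorithm = "((real \<times> 'a) \<times> (real \<times> 'a)) list \<Rightarrow> real \<times> 'a"

definition unit_tangent_bundle ::
    "((real \<times> 'a::euclidean_space) \<times> (real \<times> 'a)) set" where
  "unit_tangent_bundle = {(x, g). x \<in> hyperboloid \<and> g \<in> tangent x \<and> hnorm g = 1}"

definition is_algorithm :: "'a::euclidean_space algorithm \<Rightarrow> bool" where
  "is_algorithm A \<longleftrightarrow> (\<forall>h \<in> lists unit_tangent_bundle. A h \<in> hyperboloid)"

primrec transcript ::
    "'a algorithm \<Rightarrow> (nat \<Rightarrow> real \<times> 'a) \<Rightarrow> nat \<Rightarrow>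
      ((real \<times> 'a::euclidean_space) \<times> (real \<times> 'a)) list" where
  "transcript A g 0 = []"
| "transcript A g (Suc k) = transcript A g k @ [(A (transcript A g k), g k)]"

definition query ::
    "'a::euclidean_space algorithm \<Rightarrow> (nat \<Rightarrow> real \<times> 'a) \<Rightarrow> nat \<Rightarrow> real \<times> 'a" where
  "query A g k = A (transcript A g k)"

definition legal_responses ::
    "'a::euclidean_space algorithm \<Rightarrow> real \<times> 'a \<Rightarrow> (nat \<Rightarrow> real \<times> 'a) \<Rightarrow> bool" where
  "legal_responses A z g \<longleftrightarrow>
     (\<forall>k. g k \<in> tangent (query A g k) \<and> hnorm (g k) = 1 \<and>
          mink (hlog (query A g k) z) (g k) \<le> 0)"


section \<open>Adequacy of the model\<close>

lemma mink_add_left: "mink (u + v) w = mink u w + mink v w"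
  and mink_add_right: "mink w (u + v) = mink w u + mink w v"
  and mink_diff_left: "mink (u - v) w = mink u w - mink v w"
  and mink_diff_right: "mink w (u - v) = mink w u - mink w v"
  and mink_scaleR_left: "mink (c *\<^sub>R u) w = c * mink u w"
  and mink_scaleR_right: "mink w (c *\<^sub>R u) = c * mink w u"
  by (simp_all add: mink_def inner_simps algebra_simps)

lemma mink_commute: "mink u v = mink v u"
  by (simp add: mink_def inner_commute mult.commute)

lemmas mink_simps = mink_add_left mink_add_right mink_diff_left mink_diff_right
  mink_scaleR_left mink_scaleR_right

lemma has_real_derivative_mink:
  assumes "(f has_vector_derivative f') (at t within S)"
  shows "((\<lambda>t. mink x (f t)) has_real_derivative mink x f') (at t within S)"
proof -
  have "bounded_linear (mink x)"
    unfolding mink_def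
    by (intro bounded_linear_sub bounded_linear_inner_right_comp bounded_linear_const_mult
        bounded_linear_fst bounded_linear_snd)
  from bounded_linear.has_vector_derivative[OF this assms] show ?thesis
    by (simp add: has_real_derivative_iff_has_vector_derivative)
qed

lemma continuous_on_mink [continuous_intros]:
  "continuous_on S f \<Longrightarrow> continuous_on S g \<Longrightarrow> continuous_on S (\<lambda>t. mink (f t) (g t))"
  unfolding mink_def by (intro continuous_intros)

text \<open>The map \<open>flat p\<close> is a linear isometry from the tangent space at \<open>p\<close> to \<open>'a\<close>.\<close>

definition flat :: "real \<times> 'a::euclidean_space \<Rightarrow> real \<times> 'a \<Rightarrow> 'a" where
  "flat p u = snd u - (fst u / (1 + fst p)) *\<^sub>R snd p"

lemma mink_eq_inner_flat:
  assumes "p \<in> hyperboloid" "u \<in> tangent p" "v \<in> tangent p"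
  shows "mink u v = flat p u \<bullet> flat p v"
proof -
  let ?t = "fst p" and ?a = "fst u" and ?b = "fst v"
  have t: "?t > 0" "snd p \<bullet> snd p = (?t - 1) * (1 + ?t)"
    using assms(1) by (auto simp: hyperboloid_def mink_def algebra_simps)
  have u: "snd u \<bullet> snd p = ?t * ?a" "snd p \<bullet> snd u = ?t * ?a"
    and v: "snd v \<bullet> snd p = ?t * ?b" "snd p \<bullet> snd v = ?t * ?b"
    using assms(2,3) by (auto simp: tangent_def mink_def inner_commute)
  define k where "k = ?a / (1 + ?t)"
  define m where "m = ?b / (1 + ?t)"
  have km: "?a = k * (1 + ?t)" "?b = m * (1 + ?t)" using t(1) by (simp_all add: k_def m_def)
  have f: "flat p u = snd u - k *\<^sub>R snd p" "flat p v = snd v - m *\<^sub>R snd p"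
    by (simp_all add: flat_def k_def m_def)
  have "flat p u \<bullet> flat p v = snd u \<bullet> snd v - m * (?t * ?a) - k * (?t * ?b)
      + k * m * ((?t - 1) * (1 + ?t))"
    by (simp add: inner_diff_left inner_diff_right f u v t(2) right_diff_distrib)
  also have "\<dots> = snd u \<bullet> snd v - ?a * ?b"
    unfolding km by (simp add: algebra_simps)
  finally show ?thesis by (simp add: mink_def)
qed

lemma flat_eq_0:
  assumes "p \<in> hyperboloid" "u \<in> tangent p" "flat p u = 0"
  shows "u = 0"
proof -
  let ?t = "fst p" and ?a = "fst u"
  have t: "?t > 0" "snd p \<bullet> snd p = ?t * ?t - 1"
    using assms(1) by (auto simp: hyperboloid_def mink_def)
  have s: "snd u = (?a / (1 + ?t)) *\<^sub>R snd p"
    using assms(3) by (simp add: flat_def)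
  have "?t * ?a = (?a / (1 + ?t)) * (?t * ?t - 1)"
    using assms(2) t(2) by (simp add: tangent_def mink_def s)
  also have "\<dots> = ?a * (?t - 1)"
    using t(1) by (simp add: divide_simps) (simp add: algebra_simps)
  finally have "?a = 0" by (simp add: algebra_simps)
  with s show ?thesis by (simp add: prod_eq_iff)
qed

lemma mink_tangent_nonneg:
  assumes "p \<in> hyperboloid" "u \<in> tangent p"
  shows "mink u u \<ge> 0"
  using assms by (simp add: mink_eq_inner_flat)

lemma hnorm_flat:
  assumes "p \<in> hyperboloid" "u \<in> tangent p"
  shows "hnorm u = norm (flat p u)"
  using assms by (simp add: mink_eq_inner_flat hnorm_def norm_eq_sqrt_inner)

lemma hnorm_eq_0:
  assumes "p \<in> hyperboloid" "u \<in> tangent p"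
  shows "hnorm u = 0 \<longleftrightarrow> u = 0"
  using hnorm_flat[OF assms] flat_eq_0[OF assms] by (auto simp: hnorm_def mink_def)

lemma mink_Cauchy_Schwarz:
  assumes "p \<in> hyperboloid" "u \<in> tangent p" "v \<in> tangent p"
  shows "\<bar>mink u v\<bar> \<le> hnorm u * hnorm v"
  using assms Cauchy_Schwarz_ineq2[of "flat p u" "flat p v"]
  by (simp add: mink_eq_inner_flat hnorm_flat)

lemma hnorm_scaleR: "hnorm (c *\<^sub>R v) = \<bar>c\<bar> * hnorm v"
  by (simp add: hnorm_def mink_simps real_sqrt_mult flip: power2_eq_square mult.assoc)

lemma tangent_scaleR: "v \<in> tangent x \<Longrightarrow> c *\<^sub>R v \<in> tangent x"
  by (simp add: tangent_def mink_simps)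

lemma hnorm_power2:
  assumes "p \<in> hyperboloid" "u \<in> tangent p"
  shows "mink u u = (hnorm u)\<^sup>2" "hnorm u \<ge> 0"
  using mink_tangent_nonneg[OF assms] by (simp_all add: hnorm_def)

lemma hyperboloid_mink_ge_1:
  assumes "x \<in> hyperboloid" "y \<in> hyperboloid"
  shows "- mink x y \<ge> 1"
proof -
  have x: "fst x > 0" "(fst x)\<^sup>2 = 1 + (norm (snd x))\<^sup>2"
    and y: "fst y > 0" "(fst y)\<^sup>2 = 1 + (norm (snd y))\<^sup>2"
    unfolding power2_norm_eq_inner using assms
    by (auto simp: hyperboloid_def mink_def power2_eq_square algebra_simps)
  have "(1 + norm (snd x) * norm (snd y))\<^sup>2 \<le> (fst x * fst y)\<^sup>2"
    using sum_squares_bound[of "norm (snd x)" "norm (snd y)"]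
    by (simp add: power_mult_distrib x(2) y(2)) (simp add: power2_eq_square algebra_simps)
  hence "1 + norm (snd x) * norm (snd y) \<le> fst x * fst y"
    by (rule power2_le_imp_le) (use x(1) y(1) in simp)
  moreover have "snd x \<bullet> snd y \<le> norm (snd x) * norm (snd y)"
    by (rule norm_cauchy_schwarz)
  ultimately show ?thesis by (simp add: mink_def)
qed

lemma mink_hexp:
  assumes "x \<in> hyperboloid" "v \<in> tangent x"
  shows "mink x (hexp x v) = - cosh (hnorm v)"
  using assms by (simp add: hexp_def mink_simps hyperboloid_def tangent_def)

lemma hexp_in_hyperboloid:
  assumes "x \<in> hyperboloid" "v \<in> tangent x"
  shows "hexp x v \<in> hyperboloid"
proof -
  let ?n = "hnorm v"
  have x: "mink x x = -1" "fst x > 0" and xv: "mink x v = 0" "mink v x = 0"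
    using assms by (auto simp: hyperboloid_def tangent_def mink_commute)
  have vv: "mink v v = ?n\<^sup>2" "?n \<ge> 0" using hnorm_power2[OF assms] by auto
  have s: "(sinh ?n / ?n) * (sinh ?n / ?n) * ?n\<^sup>2 = (sinh ?n)\<^sup>2"
    by (cases "?n = 0") (auto simp: power2_eq_square)
  have "mink (hexp x v) (hexp x v)
      = - (cosh ?n)\<^sup>2 + (sinh ?n / ?n) * (sinh ?n / ?n) * ?n\<^sup>2"
    by (simp add: hexp_def mink_simps x xv vv(1)) (simp add: power2_eq_square)
  also have "\<dots> = -1" by (simp only: s) (simp add: cosh_square_eq)
  finally have m: "mink (hexp x v) (hexp x v) = -1" .
  have "fst (hexp x v) > 0"
  proof (rule ccontr)
    let ?y = "hexp x v"
    assume "\<not> fst ?y > 0"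
    moreover have "fst ?y \<noteq> 0"
    proof
      assume "fst ?y = 0"
      hence "snd ?y \<bullet> snd ?y = -1" using m by (simp add: mink_def)
      thus False using inner_ge_zero[of "snd ?y"] by linarith
    qed
    ultimately have "- ?y \<in> hyperboloid"
      using m by (simp add: hyperboloid_def mink_def)
    from hyperboloid_mink_ge_1[OF assms(1) this] have "mink x ?y \<ge> 1"
      by (simp add: mink_def)
    with mink_hexp[OF assms] cosh_real_pos[of ?n] show False by linarith
  qed
  with m show ?thesis by (simp add: hyperboloid_def)
qed

lemma hexp_surj:
  assumes "x \<in> hyperboloid" "y \<in> hyperboloid"
  shows "\<exists>v\<in>tangent x. hexp x v = y \<and> hnorm v = arcosh (- mink x y)"
proof -
  define c where "c = - mink x y"
  define w where "w = y - c *\<^sub>R x"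
  have c: "c \<ge> 1" using hyperboloid_mink_ge_1[OF assms] by (simp add: c_def)
  have xx: "mink x x = -1" "mink y y = -1" and yx: "mink y x = - c" "mink x y = - c"
    using assms by (auto simp: hyperboloid_def c_def mink_commute)
  have w: "w \<in> tangent x" by (simp add: tangent_def w_def mink_simps xx yx)
  have "mink w w = c\<^sup>2 - 1"
    by (simp add: w_def mink_simps xx yx) (simp add: power2_eq_square algebra_simps)
  hence nw: "hnorm w = sqrt (c\<^sup>2 - 1)" by (simp add: hnorm_def)
  define \<theta> where "\<theta> = arcosh c"
  have \<theta>: "\<theta> \<ge> 0" "cosh \<theta> = c" using c by (auto simp: \<theta>_def)
  have sh: "sinh \<theta> = sqrt (c\<^sup>2 - 1)" using c by (simp add: \<theta>_def sinh_arcosh_real)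
  show ?thesis
  proof (cases "\<theta> = 0")
    case True
    hence "c = 1" using \<theta>(2) by simp
    hence "hnorm w = 0" by (simp add: nw)
    hence "w = 0" using hnorm_eq_0[OF assms(1) w] by simp
    moreover have "hexp x 0 = x" by (simp add: hexp_def hnorm_def mink_def)
    ultimately show ?thesis using \<open>c = 1\<close> True
      by (intro bexI[of _ 0]) (auto simp: w_def \<theta>_def c_def hnorm_def mink_def tangent_def)
  next
    case False
    hence "sinh \<theta> > 0" using \<theta>(1) by simp
    define v where "v = (\<theta> / sinh \<theta>) *\<^sub>R w"
    have nv: "hnorm v = \<theta>"
      using \<open>sinh \<theta> > 0\<close> \<theta>(1) by (simp add: v_def hnorm_scaleR nw flip: sh)
    moreover have "v \<in> tangent x" unfolding v_def by (intro tangent_scaleR w)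
    moreover have "hexp x v = y"
      unfolding hexp_def nv using \<open>sinh \<theta> > 0\<close> False by (simp add: v_def \<theta>(2) w_def)
    ultimately show ?thesis by (auto simp: \<theta>_def c_def)
  qed
qed

lemma hnorm_eq_arcosh:
  assumes "x \<in> hyperboloid" "v \<in> tangent x"
  shows "hnorm v = arcosh (- mink x (hexp x v))"
  using hnorm_power2[OF assms] by (simp add: mink_hexp[OF assms] arcosh_cosh_real)

lemma bij_betw_hexp:
  assumes "x \<in> hyperboloid"
  shows "bij_betw (hexp x) (tangent x) hyperboloid"
  unfolding bij_betw_def
proof
  show "inj_on (hexp x) (tangent x)"
  proof (rule inj_onI)
    fix u v assume uv: "u \<in> tangent x" "v \<in> tangent x" "hexp x u = hexp x v"
    hence n: "hnorm u = hnorm v" using hnorm_eq_arcosh[OF assms] by metis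
    show "u = v"
    proof (cases "hnorm v = 0")
      case True
      thus ?thesis using n hnorm_eq_0[OF assms] uv by metis
    next
      case False
      have "(sinh (hnorm v) / hnorm v) *\<^sub>R u = (sinh (hnorm v) / hnorm v) *\<^sub>R v"
        using uv(3) by (simp add: hexp_def n)
      thus ?thesis using False by simp
    qed
  qed
  show "hexp x ` tangent x = hyperboloid"
    using hexp_in_hyperboloid[OF assms] hexp_surj[OF assms] by (auto simp: image_iff) metis
qed

lemma hlog_in_tangent:
  assumes "x \<in> hyperboloid" "y \<in> hyperboloid"
  shows "hlog x y \<in> tangent x" "hexp x (hlog x y) = y"
  using bij_betw_hexp[OF assms(1)] assms(2)
  by (auto simp: hlog_def bij_betw_def intro: the_inv_into_into f_the_inv_into_f)

text \<open>
  On a submanifold of a flat ambient space the intrinsic acceleration of a curve is the tangential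
  part of its ambient acceleration, so the second statement is the geodesic equation.
\<close>

lemma hexp_geodesic:
  assumes "x \<in> hyperboloid" "v \<in> tangent x"
  defines "\<gamma> \<equiv> \<lambda>t. hexp x (t *\<^sub>R v)"
  defines "\<gamma>' \<equiv> \<lambda>t. (hnorm v * sinh (t * hnorm v)) *\<^sub>R x + cosh (t * hnorm v) *\<^sub>R v"
  shows "(\<gamma> has_vector_derivative \<gamma>' t) (at t)"
    and "(\<gamma>' has_vector_derivative (hnorm v)\<^sup>2 *\<^sub>R \<gamma> t) (at t)"
    and "\<gamma> 0 = x" "\<gamma>' 0 = v" "hnorm (\<gamma>' t) = hnorm v"
proof -
  let ?n = "hnorm v"
  have n: "?n \<ge> 0" "mink v v = ?n\<^sup>2" using hnorm_power2[OF assms(1,2)] by auto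
  have x: "mink x x = -1" and xv: "mink x v = 0" "mink v x = 0"
    using assms(1,2) by (auto simp: hyperboloid_def tangent_def mink_commute)
  have z: "v = 0" if "?n = 0" using that hnorm_eq_0[OF assms(1,2)] by simp
  have g: "\<gamma> = (\<lambda>t. cosh (t * ?n) *\<^sub>R x + (sinh (t * ?n) / ?n) *\<^sub>R v)"
  proof
    fix t
    show "\<gamma> t = cosh (t * ?n) *\<^sub>R x + (sinh (t * ?n) / ?n) *\<^sub>R v"
      by (cases "t \<ge> 0"; cases "t = 0") (auto simp: \<gamma>_def hexp_def hnorm_scaleR abs_if)
  qed
  have dc: "((\<lambda>t. cosh (t * ?n)) has_real_derivative ?n * sinh (t * ?n)) (at t)"
    and ds: "((\<lambda>t. sinh (t * ?n)) has_real_derivative ?n * cosh (t * ?n)) (at t)" for t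
    by (auto intro!: derivative_eq_intros)
  have "(\<gamma> has_vector_derivative (?n * sinh (t * ?n)) *\<^sub>R x + (?n * cosh (t * ?n) / ?n) *\<^sub>R v) (at t)"
    unfolding g
    by (intro has_vector_derivative_add has_vector_derivative_scaleR[OF _ has_vector_derivative_const, simplified]
        DERIV_cdivide dc ds)
  moreover have "(?n * cosh (t * ?n) / ?n) *\<^sub>R v = cosh (t * ?n) *\<^sub>R v"
    using z by (cases "?n = 0") auto
  ultimately show "(\<gamma> has_vector_derivative \<gamma>' t) (at t)" by (simp only: \<gamma>'_def)
  have "(\<gamma>' has_vector_derivative (?n * (?n * cosh (t * ?n))) *\<^sub>R x + (?n * sinh (t * ?n)) *\<^sub>R v) (at t)"
    unfolding \<gamma>'_def
    by (intro has_vector_derivative_add has_vector_derivative_scaleR[OF _ has_vector_derivative_const, simplified]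
        DERIV_cmult dc ds)
  moreover have "(?n * (?n * cosh (t * ?n))) *\<^sub>R x + (?n * sinh (t * ?n)) *\<^sub>R v = ?n\<^sup>2 *\<^sub>R \<gamma> t"
    unfolding g by (cases "?n = 0") (simp_all add: scaleR_add_right power2_eq_square mult.assoc)
  ultimately show "(\<gamma>' has_vector_derivative ?n\<^sup>2 *\<^sub>R \<gamma> t) (at t)" by simp
  show "\<gamma> 0 = x" "\<gamma>' 0 = v" by (simp_all add: g \<gamma>'_def)
  have "mink (\<gamma>' t) (\<gamma>' t) = ?n\<^sup>2 * ((cosh (t * ?n))\<^sup>2 - (sinh (t * ?n))\<^sup>2)"
    by (simp add: \<gamma>'_def mink_simps x xv n) (simp add: power2_eq_square algebra_simps)
  also have "\<dots> = ?n\<^sup>2" by (simp add: cosh_square_eq)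
  finally have "sqrt (mink (\<gamma>' t) (\<gamma>' t)) = hnorm v" using n(1) by simp
  thus "hnorm (\<gamma>' t) = hnorm v" by (simp only: hnorm_def)
qed

lemma arcosh_le_curve_length:
  assumes H: "\<gamma> ` {0..1} \<subseteq> hyperboloid"
    and d: "\<And>t. t \<in> {0..1} \<Longrightarrow> (\<gamma> has_vector_derivative \<gamma>' t) (at t within {0..1})"
    and c: "continuous_on {0..1} \<gamma>'"
  shows "arcosh (- mink (\<gamma> 0) (\<gamma> 1)) \<le> integral {0..1} (\<lambda>t. hnorm (\<gamma>' t))"
proof -
  let ?L = "integral {0..1} (\<lambda>t. hnorm (\<gamma>' t))"
  define x where "x = \<gamma> 0"
  define C where "C t = - mink x (\<gamma> t)" for t
  have xH: "x \<in> hyperboloid" using H by (auto simp: x_def)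
  have gH: "\<gamma> t \<in> hyperboloid" if "t \<in> {0..1}" for t using H that by auto
  have C1: "C t \<ge> 1" if "t \<in> {0..1}" for t
    using hyperboloid_mink_ge_1[OF xH gH[OF that]] by (simp add: C_def)
  have C0: "C 0 = 1" using xH by (simp add: C_def hyperboloid_def flip: x_def)
  have dC: "(C has_real_derivative - mink x (\<gamma>' t)) (at t within {0..1})" if "t \<in> {0..1}" for t
    unfolding C_def by (intro derivative_intros has_real_derivative_mink d that)
  have tang: "\<gamma>' t \<in> tangent (\<gamma> t)" if t: "t \<in> {0..1}" for t
  proof -
    have "((\<lambda>s. snd (\<gamma> s) \<bullet> snd (\<gamma> s) - fst (\<gamma> s) * fst (\<gamma> s)) has_vector_derivative
        2 * mink (\<gamma> t) (\<gamma>' t)) (at t within {0..1})"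
      using d[OF t] unfolding has_vector_derivative_def mink_def
      by (auto intro!: derivative_eq_intros simp: inner_commute algebra_simps)
    moreover have "((\<lambda>s. -1::real) has_vector_derivative 0) (at t within {0..1})" by simp
    hence "((\<lambda>s. snd (\<gamma> s) \<bullet> snd (\<gamma> s) - fst (\<gamma> s) * fst (\<gamma> s)) has_vector_derivative 0)
        (at t within {0..1})"
      by (rule has_vector_derivative_transform[OF t, rotated])
         (use gH in \<open>auto simp: hyperboloid_def mink_def\<close>)
    ultimately have "2 * mink (\<gamma> t) (\<gamma>' t) = 0"
      using t by (intro vector_derivative_unique_within_closed_interval[of 0 1 t]) auto
    thus ?thesis by (simp add: tangent_def)
  qed
  have bound: "\<bar>mink x (\<gamma>' t)\<bar> \<le> sqrt ((C t)\<^sup>2 - 1) * hnorm (\<gamma>' t)" if t: "t \<in> {0..1}" for t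
  proof -
    let ?p = "\<gamma> t"
    define w where "w = x - C t *\<^sub>R ?p"
    have pp: "mink ?p ?p = -1" "mink x x = -1" and xp: "mink x ?p = - C t" "mink ?p x = - C t"
      using gH[OF t] xH by (auto simp: hyperboloid_def C_def mink_commute)
    have w: "w \<in> tangent ?p" by (simp add: tangent_def w_def mink_simps pp xp)
    have "mink w w = (C t)\<^sup>2 - 1"
      by (simp add: w_def mink_simps pp xp) (simp add: power2_eq_square algebra_simps)
    moreover have "mink w (\<gamma>' t) = mink x (\<gamma>' t)"
      using tang[OF t] by (simp add: w_def mink_simps tangent_def)
    ultimately show ?thesis
      using mink_Cauchy_Schwarz[OF gH[OF t] w tang[OF t]] by (simp add: hnorm_def)
  qed
  have int: "(\<lambda>t. hnorm (\<gamma>' t)) integrable_on {0..1}"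
    unfolding hnorm_def by (intro integrable_continuous_interval continuous_intros c)
  have eta: "ln (C 1 + sqrt ((C 1)\<^sup>2 - 1 + \<eta>)) - ln (1 + sqrt \<eta>) \<le> ?L" if \<eta>: "\<eta> > 0" for \<eta>
  proof -
    define s where "s t = sqrt ((C t)\<^sup>2 - 1 + \<eta>)" for t
    define f where "f t = ln (C t + s t)" for t
    have p: "(C t)\<^sup>2 - 1 + \<eta> > 0" "(C t)\<^sup>2 - 1 \<ge> 0" if "t \<in> {0..1}" for t
      using one_le_power[OF C1[OF that], of 2] \<eta> by auto
    have df: "(f has_real_derivative (- mink x (\<gamma>' t)) / s t) (at t within {0..1})"
      if t: "t \<in> {0..1}" for t
    proof -
      have sp: "s t > 0" using p[OF t] by (simp add: s_def)
      have "(s has_real_derivative C t * (- mink x (\<gamma>' t)) / s t) (at t within {0..1})"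
        unfolding s_def using p[OF t]
        by (auto intro!: derivative_eq_intros dC t simp: divide_simps)
      hence "(f has_real_derivative
          (- mink x (\<gamma>' t) + C t * (- mink x (\<gamma>' t)) / s t) * (1 / (C t + s t))) (at t within {0..1})"
        unfolding f_def using C1[OF t] sp
        by (auto intro!: derivative_eq_intros dC t)
      moreover have "(- mink x (\<gamma>' t) + C t * (- mink x (\<gamma>' t)) / s t) * (1 / (C t + s t))
          = (- mink x (\<gamma>' t)) / s t"
        using C1[OF t] sp by (simp add: divide_simps) (simp add: algebra_simps)
      ultimately show ?thesis by simp
    qed
    have fi: "((\<lambda>t. (- mink x (\<gamma>' t)) / s t) has_integral f 1 - f 0) {0..1}"
      by (rule fundamental_theorem_of_calculus)
         (use df in \<open>auto simp: has_real_derivative_iff_has_vector_derivative\<close>)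
    have "f 1 - f 0 \<le> ?L"
    proof (rule has_integral_le[OF fi integrable_integral[OF int]])
      fix t :: real assume t: "t \<in> {0..1}"
      have sp: "s t > 0" using p[OF t] by (simp add: s_def)
      have "- mink x (\<gamma>' t) \<le> sqrt ((C t)\<^sup>2 - 1) * hnorm (\<gamma>' t)" using bound[OF t] by linarith
      also have "\<dots> \<le> s t * hnorm (\<gamma>' t)"
        using \<eta> hnorm_power2(2)[OF gH[OF t] tang[OF t]] by (intro mult_right_mono) (auto simp: s_def)
      finally show "(- mink x (\<gamma>' t)) / s t \<le> hnorm (\<gamma>' t)"
        using sp by (simp add: divide_simps mult.commute)
    qed
    thus ?thesis by (simp add: f_def s_def C0)
  qed
  have c1: "C 1 \<ge> 1" using C1 by simp
  have "((\<lambda>\<eta>. ln (C 1 + sqrt ((C 1)\<^sup>2 - 1 + \<eta>)) - ln (1 + sqrt \<eta>)) \<longlongrightarrow>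
      ln (C 1 + sqrt ((C 1)\<^sup>2 - 1 + 0)) - ln (1 + sqrt 0)) (at_right 0)"
  proof -
    have "C 1 + sqrt ((C 1)\<^sup>2 - 1) > 0"
      using c1 one_le_power[OF c1, of 2] by (intro add_pos_nonneg) auto
    thus ?thesis by (intro tendsto_intros) auto
  qed
  hence "ln (C 1 + sqrt ((C 1)\<^sup>2 - 1 + 0)) - ln (1 + sqrt 0) \<le> ?L"
  proof (rule tendsto_upperbound)
    show "\<forall>\<^sub>F \<eta> in at_right 0. ln (C 1 + sqrt ((C 1)\<^sup>2 - 1 + \<eta>)) - ln (1 + sqrt \<eta>) \<le> ?L"
      using eta by (intro eventually_at_rightI[of 0 1]) simp_all
  qed simp
  hence "arcosh (C 1) \<le> ?L" by (simp add: arcosh_real_def[OF c1])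
  thus ?thesis by (simp only: C_def x_def)
qed

lemma hdist_eq_arcosh:
  assumes "x \<in> hyperboloid" "y \<in> hyperboloid"
  shows "hdist x y = arcosh (- mink x y)"
  unfolding hdist_def
proof (rule cInf_eq_minimum)
  obtain v where v: "v \<in> tangent x" "hexp x v = y" "hnorm v = arcosh (- mink x y)"
    using hexp_surj[OF assms] by auto
  define \<gamma> where "\<gamma> t = hexp x (t *\<^sub>R v)" for t
  define \<gamma>' where "\<gamma>' t = (hnorm v * sinh (t * hnorm v)) *\<^sub>R x + cosh (t * hnorm v) *\<^sub>R v" for t
  note geo = hexp_geodesic[OF assms(1) v(1), folded \<gamma>_def \<gamma>'_def]
  have "hnorm v = integral {0..1} (\<lambda>t. hnorm (\<gamma>' t))" by (simp add: geo(5))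
  moreover have "continuous_on {0..1} \<gamma>'"
    unfolding \<gamma>'_def by (intro continuous_intros)
  moreover have "\<gamma> ` {0..1} \<subseteq> hyperboloid"
    using hexp_in_hyperboloid[OF assms(1) tangent_scaleR[OF v(1)]] by (auto simp: \<gamma>_def)
  moreover have "\<gamma> 1 = y" by (simp add: \<gamma>_def v)
  ultimately show "arcosh (- mink x y) \<in> curve_lengths x y"
    unfolding curve_lengths_def v(3)[symmetric]
    using geo(1,3) by (blast intro: has_vector_derivative_at_within)
next
  fix l assume "l \<in> curve_lengths x y"
  then obtain \<gamma> \<gamma>' where "\<gamma> ` {0..1} \<subseteq> hyperboloid" "continuous_on {0..1} \<gamma>'"
      "\<And>t. t \<in> {0..1} \<Longrightarrow> (\<gamma> has_vector_derivative \<gamma>' t) (at t within {0..1})"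
    and l: "l = integral {0..1} (\<lambda>t. hnorm (\<gamma>' t))" "\<gamma> 0 = x" "\<gamma> 1 = y"
    unfolding curve_lengths_def by blast
  hence "arcosh (- mink (\<gamma> 0) (\<gamma> 1)) \<le> l" unfolding l(1) by (intro arcosh_le_curve_length)
  thus "arcosh (- mink x y) \<le> l" by (simp only: l)
qed

lemma hdist_hexp:
  assumes "x \<in> hyperboloid" "v \<in> tangent x"
  shows "hdist x (hexp x v) = hnorm v"
  using hdist_eq_arcosh[OF assms(1) hexp_in_hyperboloid[OF assms]] hnorm_eq_arcosh[OF assms] by simp

end

theory Submission
  imports Defs
begin

text \<open>
  Let \<open>a = \<epsilon> r\<close>. A horosphere through \<open>xref\<close> is intrinsically a Euclidean space of dimension
  \<open>d - 1\<close>, and hyperbolic distances on it grow like twice the logarithm of the Euclidean ones: a cubic lattice on it provides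
  \<open>exp (c (d - 1) r)\<close> points of the ball with mutual distances at least \<open>4 a\<close>. Whatever point \<open>x\<close> is
  queried, at most one of these candidates is closer than \<open>2 a\<close> to \<open>x\<close>. Let \<open>g\<close> be a uniformly
  random sign vector in an orthonormal basis of the tangent space, normalised. Any other candidate
  lies, with probability at least \<open>1/4\<close>, strictly on the side of the hyperplane allowed by \<open>g\<close> and at
  distance more than \<open>a\<close> from it. So some response keeps a quarter of these candidates alive, and the
  oracle survives about \<open>log\<^sub>4\<close> of their initial number of queries.
\<close>

section \<open>Hyperplanes and tangent spaces\<close>

text \<open>The \<open>x\<close> part of \<open>hexp x v\<close> pairs to zero with
  \<open>g\<close>, and the factor in front of \<open>v\<close> is positive when \<open>v\<close> is
  nonzero.\<close>

lemma mink_hexp_sign: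
  assumes "x \<in> hyperboloid" "v \<in> tangent x" "g \<in> tangent x" "mink (hexp x v) g \<le> 0"
  shows "mink v g \<le> 0"
proof (cases "hnorm v = 0")
  case True
  hence "v = 0" using assms hnorm_eq_0 by blast
  thus ?thesis by (simp add: mink_def)
next
  case False
  hence n: "hnorm v > 0" using hnorm_power2(2)[OF assms(1,2)] by linarith
  have "mink (hexp x v) g = (sinh (hnorm v) / hnorm v) * mink v g"
    using assms(3) by (simp add: hexp_def mink_simps tangent_def)
  thus ?thesis using assms(4) n by (simp add: mult_le_0_iff divide_le_0_iff)
qed

text \<open>This removes the logarithm from the game: a response is legal for \<open>z\<close> as
  soon as the ambient form \<open>mink z g\<close> is nonpositive.\<close>

lemma mink_hlog_nonpos:
  assumes "x \<in> hyperboloid" "z \<in> hyperboloid" "g \<in> tangent x" "mink z g \<le> 0"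
  shows "mink (hlog x z) g \<le> 0"
  using mink_hexp_sign[OF assms(1) hlog_in_tangent(1)[OF assms(1,2)] assms(3)]
    hlog_in_tangent(2)[OF assms(1,2)] assms(4) by simp

text \<open>The vector is the projection of \<open>z\<close> to the tangent space at
  \<open>x\<close>. As \<open>- mink x z\<close> is the cosh of the distance, its norm is the
  sinh.\<close>

lemma hyperboloid_decompose:
  assumes "x \<in> hyperboloid" "z \<in> hyperboloid"
  shows "z + mink x z *\<^sub>R x \<in> tangent x"
    and "hnorm (z + mink x z *\<^sub>R x) = sqrt ((mink x z)\<^sup>2 - 1)"
proof -
  have xx: "mink x x = -1" "mink z z = -1" "mink z x = mink x z"
    using assms by (auto simp: hyperboloid_def mink_commute)
  show "z + mink x z *\<^sub>R x \<in> tangent x"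
    by (simp add: tangent_def mink_simps xx)
  have "mink (z + mink x z *\<^sub>R x) (z + mink x z *\<^sub>R x) = (mink x z)\<^sup>2 - 1"
    by (simp add: mink_simps xx power2_eq_square)
  thus "hnorm (z + mink x z *\<^sub>R x) = sqrt ((mink x z)\<^sup>2 - 1)"
    by (simp add: hnorm_def)
qed

text \<open>Every point \<open>y\<close> of the hyperplane is orthogonal to \<open>g\<close>, so
  \<open>g\<close> is also a unit tangent vector at \<open>y\<close>. Cauchy-Schwarz there, against
  the projection of \<open>z\<close>, bounds \<open>- mink z g\<close> by the sinh of the distance
  from \<open>z\<close> to \<open>y\<close>.\<close>

lemma hdist_set_hhyperplane_gt:
  assumes "x \<in> hyperboloid" "z \<in> hyperboloid" "g \<in> tangent x" "hnorm g = 1"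
    and "mink z g < - sinh a"
  shows "hdist_set z (hhyperplane x g) > a"
proof -
  have "arsinh (- mink z g) \<le> hdist z y" if y: "y \<in> hhyperplane x g" for y
  proof -
    obtain v where v: "v \<in> tangent x" "mink v g = 0" "y = hexp x v"
      using y by (auto simp: hhyperplane_def)
    have yH: "y \<in> hyperboloid" using v assms(1) by (simp add: hexp_in_hyperboloid)
    have yg: "mink y g = 0" using v assms(3) by (simp add: hexp_def mink_simps tangent_def)
    hence gy: "g \<in> tangent y" by (simp add: tangent_def)
    define c where "c = - mink z y"
    have c: "c \<ge> 1" using hyperboloid_mink_ge_1[OF assms(2) yH] by (simp add: c_def)
    define u where "u = z + mink y z *\<^sub>R y"
    note u = hyperboloid_decompose[OF yH assms(2), folded u_def]
    have "mink u g = mink z g" by (simp add: u_def mink_simps yg)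
    moreover have "hnorm u = sinh (arcosh c)"
      using c by (simp add: u c_def sinh_arcosh_real mink_commute)
    ultimately have "- mink z g \<le> sinh (arcosh c)"
      using mink_Cauchy_Schwarz[OF yH u(1) gy] assms(4) by simp
    hence "arsinh (- mink z g) \<le> arcosh c"
      by (metis sinh_arsinh_real sinh_real_le_iff)
    thus ?thesis by (simp add: hdist_eq_arcosh[OF assms(2) yH] c_def)
  qed
  \<comment> \<open>The bound on the infimum requires a nonempty hyperplane.\<close>
  moreover have "hexp x 0 \<in> hhyperplane x g"
    unfolding hhyperplane_def by (rule imageI) (simp add: tangent_def mink_def)
  ultimately have "arsinh (- mink z g) \<le> hdist_set z (hhyperplane x g)"
    unfolding hdist_set_def by (intro cINF_greatest) auto
  moreover have "a < arsinh (- mink z g)"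
    using assms(5) arsinh_less_iff_real[of "sinh a" "- mink z g"] by (simp add: arsinh_sinh_real)
  ultimately show ?thesis by linarith
qed

text \<open>The inverse of \<open>flat p\<close>.\<close>

definition lift :: "real \<times> 'a::euclidean_space \<Rightarrow> 'a \<Rightarrow> real \<times> 'a" where
  "lift p w = (snd p \<bullet> w, w + ((snd p \<bullet> w) / (1 + fst p)) *\<^sub>R snd p)"

lemma flat_lift: "flat p (lift p w) = w"
  by (simp add: flat_def lift_def)

lemma lift_tangent:
  assumes "p \<in> hyperboloid"
  shows "lift p w \<in> tangent p"
proof -
  have t: "fst p > 0" "snd p \<bullet> snd p = (fst p - 1) * (1 + fst p)"
    using assms by (auto simp: hyperboloid_def mink_def algebra_simps)
  have "(snd p \<bullet> w) / (1 + fst p) * (snd p \<bullet> snd p) = (snd p \<bullet> w) * (fst p - 1)"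
    using t(1) by (simp add: t(2))
  thus ?thesis
    by (simp add: tangent_def mink_def lift_def inner_add_right algebra_simps)
qed

lemma mink_lift:
  assumes "p \<in> hyperboloid"
  shows "mink (lift p u) (lift p v) = u \<bullet> v"
  using mink_eq_inner_flat[OF assms lift_tangent lift_tangent] assms by (simp add: flat_lift)

lemma hnorm_lift:
  assumes "p \<in> hyperboloid"
  shows "hnorm (lift p u) = norm u"
  by (simp add: hnorm_def mink_lift[OF assms] norm_eq_sqrt_inner)


section \<open>A lattice on a horosphere\<close>

text \<open>
  The vector \<open>p + lift p b\<close> is null for a unit vector \<open>b\<close>, and the orthogonal complement of \<open>b\<close>
  parametrises the corresponding horosphere through \<open>p\<close>.
\<close>

definition horo :: "real \<times> 'a::euclidean_space \<Rightarrow> 'a \<Rightarrow> 'a \<Rightarrow> real \<times> 'a" where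
  "horo p b w = p + lift p w + ((norm w)\<^sup>2 / 2) *\<^sub>R (p + lift p b)"

text \<open>The vector \<open>p + lift p b\<close> is null, pairs to -1 with \<open>p\<close> and to
  0 with the lifts of \<open>u\<close> and \<open>v\<close>. What remains is
  \<open>-1 + u \<bullet> v\<close> minus half of both squared norms.\<close>

lemma mink_horo:
  assumes p: "p \<in> hyperboloid" and "norm b = 1" "b \<bullet> u = 0" "b \<bullet> v = 0"
  shows "mink (horo p b u) (horo p b v) = - 1 - (norm (u - v))\<^sup>2 / 2"
proof -
  have [simp]: "mink p p = -1" "mink p (lift p w) = 0" "mink (lift p w) p = 0" for w
    using lift_tangent[OF p, of w] p by (auto simp: hyperboloid_def tangent_def mink_commute)
  have [simp]: "b \<bullet> b = 1" "u \<bullet> b = 0" "v \<bullet> b = 0"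
    using assms by (auto simp: inner_commute norm_eq_sqrt_inner)
  have "(norm (u - v))\<^sup>2 = (norm u)\<^sup>2 + (norm v)\<^sup>2 - 2 * (u \<bullet> v)"
    by (simp add: power2_norm_eq_inner inner_diff_left inner_diff_right inner_commute)
  thus ?thesis
    by (simp add: horo_def mink_simps mink_lift[OF p] assms field_simps)
qed

lemma horo_0: "horo p b 0 = p"
  by (simp add: horo_def lift_def zero_prod_def[symmetric])

lemma horo_in_hyperboloid:
  assumes p: "p \<in> hyperboloid" and "norm b = 1" "b \<bullet> u = 0"
  shows "horo p b u \<in> hyperboloid"
proof -
  let ?h = "horo p b u"
  have m: "mink ?h ?h = -1" using mink_horo[OF assms assms(3)] by simp
  have ph: "mink p ?h = - 1 - (norm u)\<^sup>2 / 2"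
    using mink_horo[OF assms(1,2) _ assms(3), of 0] by (simp add: horo_0)
  have "fst ?h > 0"
  proof (rule ccontr)
    assume "\<not> fst ?h > 0"
    moreover have "fst ?h \<noteq> 0"
    proof
      assume "fst ?h = 0"
      hence "snd ?h \<bullet> snd ?h = -1" using m by (simp add: mink_def)
      thus False using inner_ge_zero[of "snd ?h"] by linarith
    qed
    \<comment> \<open>On the lower sheet, the antipode of \<open>?h\<close> would be a point of the
      hyperboloid, forcing \<open>mink p ?h\<close> to be at least 1, whereas \<open>ph\<close>
      makes it at most -1.\<close>
    ultimately have "- ?h \<in> hyperboloid"
      using m by (simp add: hyperboloid_def mink_def)
    from hyperboloid_mink_ge_1[OF p this] have "mink p ?h \<ge> 1"
      by (simp add: mink_def)
    with ph show False using zero_le_power2[of "norm u"] by linarith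
  qed
  with m show ?thesis by (simp add: hyperboloid_def)
qed

text \<open>The lattice spacing \<open>\<delta> = 2 * sinh s\<close> is chosen so that
  \<open>1 + \<delta>\<^sup>2 / 2 = cosh (2 * s)\<close>, the value of \<open>- mink\<close> for
  adjacent lattice points. The hypothesis on \<open>M\<close> keeps the far corner of the cube in
  the ball.\<close>

lemma horo_packing:
  fixes p :: "real \<times> 'a::euclidean_space"
  assumes p: "p \<in> hyperboloid" and "s > 0" "r \<ge> 0"
    and M: "real (DIM('a) - 1) * (2 * (sinh s)\<^sup>2 * (real M)\<^sup>2) \<le> cosh r - 1"
  obtains C where "finite C" "card C = M ^ (DIM('a) - 1)" "C \<subseteq> hball p r"
    "\<And>z z'. z \<in> C \<Longrightarrow> z' \<in> C \<Longrightarrow> z \<noteq> z' \<Longrightarrow> cosh (2 * s) \<le> - mink z z'"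
proof -
  obtain b0 :: 'a where b0: "b0 \<in> Basis" using nonempty_Basis by blast
  define B where "B = Basis - {b0}"
  have B: "finite B" "card B = DIM('a) - 1" using b0 by (auto simp: B_def)
  define \<delta> where "\<delta> = 2 * sinh s"
  define F where "F = PiE B (\<lambda>_. {..<M})"
  define w :: "('a \<Rightarrow> nat) \<Rightarrow> 'a" where "w m = (\<Sum>b\<in>B. (\<delta> * real (m b)) *\<^sub>R b)" for m
  have \<delta>: "\<delta> > 0" using assms by (simp add: \<delta>_def)
  have nw: "(norm (\<Sum>b\<in>B. c b *\<^sub>R b))\<^sup>2 = (\<Sum>b\<in>B. (c b)\<^sup>2)" for c :: "'a \<Rightarrow> real"
  proof -
    have "(norm (\<Sum>b\<in>B. c b *\<^sub>R b))\<^sup>2 = (\<Sum>b\<in>B. (norm (c b *\<^sub>R b))\<^sup>2)"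
      by (rule norm_sum_Pythagorean)
         (auto simp: B(1) B_def pairwise_def orthogonal_def inner_Basis)
    also have "\<dots> = (\<Sum>b\<in>B. (c b)\<^sup>2)" by (intro sum.cong) (auto simp: B_def)
    finally show ?thesis .
  qed
  have orth: "b0 \<bullet> w m = 0" for m
    unfolding w_def inner_sum_right using b0
    by (intro sum.neutral) (auto simp: B_def inner_Basis)
  have b01: "norm b0 = 1" using b0 by simp
  define f where "f m = horo p b0 (w m)" for m
  have fH: "f m \<in> hyperboloid" for m unfolding f_def by (intro horo_in_hyperboloid p b01 orth)
  have sep: "cosh (2 * s) \<le> - mink (f m) (f m')" if "m \<in> F" "m' \<in> F" "m \<noteq> m'" for m m'
  proof -
    have "\<exists>b\<in>B. m b \<noteq> m' b"
      using PiE_ext[OF that(1,2)[unfolded F_def]] that(3) by auto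
    then obtain b where b: "b \<in> B" "m b \<noteq> m' b" by blast
    have "w m - w m' = (\<Sum>b\<in>B. (\<delta> * (real (m b) - real (m' b))) *\<^sub>R b)"
      by (simp add: w_def sum_subtractf algebra_simps)
    hence "(norm (w m - w m'))\<^sup>2 = (\<Sum>b\<in>B. (\<delta> * (real (m b) - real (m' b)))\<^sup>2)"
      by (simp only: nw)
    also have "\<dots> \<ge> (\<delta> * (real (m b) - real (m' b)))\<^sup>2"
      by (rule member_le_sum) (use b B in auto)
    also have "(\<delta> * (real (m b) - real (m' b)))\<^sup>2 \<ge> \<delta>\<^sup>2 * 1"
    proof -
      have "\<bar>real (m b) - real (m' b)\<bar> \<ge> 1" using b(2) by linarith
      hence "(real (m b) - real (m' b))\<^sup>2 \<ge> 1"
        by (metis one_power2 abs_le_square_iff abs_one)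
      thus ?thesis unfolding power_mult_distrib by (intro mult_left_mono) auto
    qed
    finally have "(norm (w m - w m'))\<^sup>2 \<ge> \<delta>\<^sup>2" by simp
    moreover have "cosh (2 * s) = 1 + \<delta>\<^sup>2 / 2"
      by (simp add: \<delta>_def cosh_double cosh_square_eq power_mult_distrib)
    ultimately show ?thesis
      unfolding f_def mink_horo[OF p b01 orth orth] by simp
  qed
  have ball: "f m \<in> hball p r" if m: "m \<in> F" for m
  proof -
    have "(norm (w m))\<^sup>2 = (\<Sum>b\<in>B. (\<delta> * real (m b))\<^sup>2)" unfolding w_def by (rule nw)
    also have "\<dots> \<le> (\<Sum>b\<in>B. (\<delta> * real M)\<^sup>2)"
      using m \<delta> by (intro sum_mono power_mono mult_left_mono) (auto simp: F_def PiE_def Pi_def less_imp_le)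
    also have "\<dots> = 2 * (real (DIM('a) - 1) * (2 * (sinh s)\<^sup>2 * (real M)\<^sup>2))"
      by (simp add: B \<delta>_def power_mult_distrib)
    also have "\<dots> \<le> 2 * (cosh r - 1)" using M by simp
    finally have "- mink p (f m) \<le> cosh r"
      using mink_horo[OF p b01 _ orth, of 0 m] by (simp add: f_def horo_0)
    hence "arcosh (- mink p (f m)) \<le> r"
      using hyperboloid_mink_ge_1[OF p fH] \<open>r \<ge> 0\<close>
      by (metis arcosh_cosh_real arcosh_less_iff_real cosh_real_ge_1 not_le)
    thus ?thesis by (simp add: hball_def fH hdist_eq_arcosh[OF p fH])
  qed
  \<comment> \<open>Distinct indices with one image would be separated from themselves, but
    \<open>- mink z z = 1 < cosh (2 * s)\<close>.\<close>
  have inj: "inj_on f F"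
  proof (rule inj_onI, rule ccontr)
    fix m m' assume "m \<in> F" "m' \<in> F" "f m = f m'" "m \<noteq> m'"
    hence "cosh (2 * s) \<le> 1" using sep[of m m'] fH[of m'] by (simp add: hyperboloid_def)
    thus False using \<open>s > 0\<close> cosh_real_strict_mono[of 0 "2 * s"] by simp
  qed
  show ?thesis
  proof (rule that[of "f ` F"])
    show "finite (f ` F)" using B by (auto simp: F_def intro: finite_PiE)
    show "card (f ` F) = M ^ (DIM('a) - 1)"
      unfolding card_image[OF inj] using B by (simp add: F_def card_PiE)
    show "f ` F \<subseteq> hball p r" using ball by auto
    show "cosh (2 * s) \<le> - mink z z'" if "z \<in> f ` F" "z' \<in> f ` F" "z \<noteq> z'" for z z'
      using that sep by auto
  qed
qed


section \<open>Random sign vectors\<close>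

text \<open>Signs are encoded by the set of coordinates with sign +1, so that probabilities become
  cardinalities of subsets of \<open>Pow Basis\<close>.\<close>

definition signvec :: "'a::euclidean_space set \<Rightarrow> 'a" where
  "signvec S = (\<Sum>b\<in>Basis. (if b \<in> S then 1 else -1) *\<^sub>R b)"

lemma norm_signvec: "norm (signvec S :: 'a::euclidean_space) = sqrt (real DIM('a))"
proof -
  have "signvec S \<bullet> b = (if b \<in> S then 1 else -1)" if "b \<in> Basis" for b :: 'a
    using that unfolding signvec_def by (rule inner_sum_left_Basis)
  hence "signvec S \<bullet> (signvec S :: 'a) = (\<Sum>b\<in>(Basis::'a set). 1)"
    by (subst euclidean_inner) (intro sum.cong, auto)
  thus ?thesis by (simp add: norm_eq_sqrt_inner)
qed

lemma exists_large_coordinate: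
  fixes w :: "'a::euclidean_space"
  obtains b where "b \<in> Basis" "norm w \<le> sqrt (real DIM('a)) * \<bar>w \<bullet> b\<bar>"
proof -
  obtain b where b: "b \<in> Basis" "(MAX c\<in>Basis. \<bar>w \<bullet> c\<bar>) = \<bar>w \<bullet> b\<bar>"
    by (rule obtains_MAX[OF finite_Basis nonempty_Basis, of "\<lambda>c. \<bar>w \<bullet> c\<bar>"]) simp
  have max: "\<bar>w \<bullet> c\<bar> \<le> \<bar>w \<bullet> b\<bar>" if "c \<in> Basis" for c
    using that unfolding b(2)[symmetric] by (intro Max_ge) auto
  have "w \<bullet> w = (\<Sum>c\<in>Basis. (w \<bullet> c)\<^sup>2)"
    by (subst euclidean_inner) (simp add: power2_eq_square)
  also have "\<dots> \<le> (\<Sum>c\<in>(Basis :: 'a set). (w \<bullet> b)\<^sup>2)"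
    using max by (intro sum_mono) (simp add: abs_le_square_iff)
  also have "\<dots> = (sqrt (real DIM('a)) * \<bar>w \<bullet> b\<bar>)\<^sup>2" by (simp add: power_mult_distrib)
  finally have "norm w \<le> sqrt (real DIM('a)) * \<bar>w \<bullet> b\<bar>"
    unfolding power2_norm_eq_inner[symmetric] by (rule power2_le_imp_le) simp
  with b(1) show ?thesis by (rule that)
qed

text \<open>
  Flipping the sign of one coordinate \<open>\<bar>w \<bullet> b\<bar> \<ge> t\<close> moves the inner product by at least \<open>2 t\<close>, and
  flipping all signs negates it. So each orbit of these two involutions contains a good sign vector.
\<close>

lemma card_good_signs:
  fixes w :: "'a::euclidean_space"
  shows "2 ^ DIM('a) \<le> 4 * card {S \<in> Pow Basis. sqrt (real DIM('a)) * (w \<bullet> signvec S) \<le> - norm w}"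
    (is "_ \<le> 4 * card ?G")
proof -
  obtain b where b: "b \<in> Basis" "norm w \<le> sqrt (real DIM('a)) * \<bar>w \<bullet> b\<bar>"
    by (rule exists_large_coordinate)
  define flip where "flip S = (if b \<in> S then S - {b} else insert b S)" for S
  have flip2: "flip (flip S) = S" for S by (auto simp: flip_def)
  define neg where "neg S = Basis - S" for S :: "'a set"
  define X where "X S = w \<bullet> signvec S" for S
  have Xsum: "X S = (\<Sum>c\<in>Basis. (if c \<in> S then 1 else -1) * (w \<bullet> c))" for S
    by (simp add: X_def signvec_def inner_sum_right)
  have Xneg: "X (neg S) = - X S" for S
    unfolding Xsum neg_def by (subst sum_negf[symmetric]) (intro sum.cong, auto)
  have Xflip: "\<bar>X S - X (flip S)\<bar> = 2 * \<bar>w \<bullet> b\<bar>" for S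
  proof -
    have R: "X S' = (if b \<in> S' then 1 else -1) * (w \<bullet> b)
        + (\<Sum>c\<in>Basis - {b}. (if c \<in> S' then 1 else -1) * (w \<bullet> c))" for S'
      unfolding Xsum by (subst sum.remove[OF _ b(1)]) auto
    have "(\<Sum>c\<in>Basis - {b}. (if c \<in> flip S then 1 else -1) * (w \<bullet> c))
        = (\<Sum>c\<in>Basis - {b}. (if c \<in> S then 1 else -1) * (w \<bullet> c))"
      by (intro sum.cong) (auto simp: flip_def)
    thus ?thesis using R[of S] R[of "flip S"] by (auto simp: flip_def)
  qed
  have "Pow Basis \<subseteq> (?G \<union> flip ` ?G) \<union> (neg ` ?G \<union> flip ` neg ` ?G)"
  proof
    fix S :: "'a set" assume S: "S \<in> Pow Basis"
    have G: "S' \<in> ?G" if "S' \<in> Pow Basis" "X S' \<le> - \<bar>w \<bullet> b\<bar>" for S'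
    proof -
      have "sqrt (real DIM('a)) * X S' \<le> sqrt (real DIM('a)) * (- \<bar>w \<bullet> b\<bar>)"
        using that(2) by (intro mult_left_mono) auto
      thus ?thesis using b(2) that(1) by (simp add: X_def)
    qed
    have P: "flip S \<in> Pow Basis" "neg S \<in> Pow Basis" "neg (flip S) \<in> Pow Basis"
      using S b(1) by (auto simp: flip_def neg_def split: if_splits)
    have N: "neg (neg S) = S" "flip (neg (neg (flip S))) = S"
      using S P(1) flip2[of S] by (auto simp: neg_def double_diff)
    \<comment> \<open>Two numbers at distance \<open>2 * \<bar>w \<bullet> b\<bar>\<close> cannot
      both have smaller absolute value than \<open>\<bar>w \<bullet> b\<bar>\<close>;
      \<open>neg\<close> turns a large positive value into a large negative one.\<close>
    from Xflip[of S] consider "X S \<le> - \<bar>w \<bullet> b\<bar>" | "X (flip S) \<le> - \<bar>w \<bullet> b\<bar>"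
      | "X (neg S) \<le> - \<bar>w \<bullet> b\<bar>" | "X (neg (flip S)) \<le> - \<bar>w \<bullet> b\<bar>"
      unfolding Xneg by linarith
    thus "S \<in> (?G \<union> flip ` ?G) \<union> (neg ` ?G \<union> flip ` neg ` ?G)"
    proof cases
      case 1
      thus ?thesis using G S by blast
    next
      case 2
      hence "flip (flip S) \<in> flip ` ?G" by (intro imageI G P)
      thus ?thesis by (simp add: flip2)
    next
      case 3
      hence "neg (neg S) \<in> neg ` ?G" by (intro imageI G P)
      thus ?thesis by (simp add: N)
    next
      case 4
      hence "flip (neg (neg (flip S))) \<in> flip ` neg ` ?G" by (intro imageI G P)
      thus ?thesis by (simp add: N)
    qed
  qed
  moreover have fin: "finite ?G" by simp
  ultimately have "card (Pow (Basis :: 'a set)) \<le> card ((?G \<union> flip ` ?G) \<union> (neg ` ?G \<union> flip ` neg ` ?G))"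
    by (intro card_mono) auto
  also have "\<dots> \<le> (card ?G + card (flip ` ?G)) + (card (neg ` ?G) + card (flip ` neg ` ?G))"
    by (intro order_trans[OF card_Un_le] add_mono order_refl card_Un_le)
  also have "\<dots> \<le> (card ?G + card ?G) + (card ?G + card ?G)"
    by (intro add_mono order_refl card_image_le order_trans[OF card_image_le card_image_le]
        finite_imageI fin)
  finally show ?thesis by (simp add: card_Pow)
qed

text \<open>Double counting of the pairs related by \<open>P\<close>: some \<open>i\<close> does at
  least as well as the average. It replaces the expectation over random signs.\<close>

lemma exists_popular:
  assumes "finite I" "finite C" "I \<noteq> {}"
    and "\<And>z. z \<in> C \<Longrightarrow> card I \<le> q * card {i \<in> I. P i z}"
  shows "\<exists>i\<in>I. card C \<le> q * card {z \<in> C. P i z}"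
proof (rule ccontr)
  assume "\<not> ?thesis"
  hence "(\<Sum>i\<in>I. q * card {z \<in> C. P i z}) < (\<Sum>i\<in>I. card C)"
    using assms by (intro sum_strict_mono) (auto simp: not_le)
  also have "(\<Sum>i\<in>I. card C) = (\<Sum>z\<in>C. card I)" by simp
  also have "\<dots> \<le> (\<Sum>z\<in>C. q * card {i \<in> I. P i z})" by (intro sum_mono assms)
  also have "\<dots> = (\<Sum>i\<in>I. q * card {z \<in> C. P i z})"
    unfolding sum_distrib_left[symmetric] using assms
    by (simp add: sum_multicount_gen)
  finally show False by simp
qed


section \<open>The oracle\<close>

text \<open>A triangle inequality in cosh form: the projections of \<open>z\<close> and
  \<open>z'\<close> at \<open>x\<close> have norm at most \<open>\<bar>sinh s\<bar>\<close>, and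
  \<open>cosh (2 * s)\<close> is the sum of the squares of \<open>cosh s\<close> and
  \<open>sinh s\<close>.\<close>

lemma near_unique:
  assumes "x \<in> hyperboloid" "z \<in> hyperboloid" "z' \<in> hyperboloid"
    and "- mink x z < cosh s" "- mink x z' < cosh s"
  shows "- mink z z' < cosh (2 * s)"
proof -
  let ?u = "z + mink x z *\<^sub>R x" and ?u' = "z' + mink x z' *\<^sub>R x"
  note u = hyperboloid_decompose[OF assms(1,2)] and u' = hyperboloid_decompose[OF assms(1,3)]
  have xx: "mink x x = -1" "mink z x = mink x z" "mink z' x = mink x z'"
    using assms by (auto simp: hyperboloid_def mink_commute)
  have c: "- mink x z \<ge> 1" "- mink x z' \<ge> 1"
    using assms(1-3) by (simp_all only: hyperboloid_mink_ge_1)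
  have "(mink x z)\<^sup>2 < (cosh s)\<^sup>2" "(mink x z')\<^sup>2 < (cosh s)\<^sup>2"
    using power_strict_mono[OF assms(4), of 2] power_strict_mono[OF assms(5), of 2] c by auto
  hence n: "hnorm ?u \<le> \<bar>sinh s\<bar>" "hnorm ?u' \<le> \<bar>sinh s\<bar>"
    by (auto simp: u u' cosh_square_eq intro!: real_le_lsqrt)
  have "mink ?u ?u' = mink z z' + mink x z * mink x z'"
    by (simp add: mink_simps xx)
  hence "- mink z z' \<le> (- mink x z) * (- mink x z') + hnorm ?u * hnorm ?u'"
    using mink_Cauchy_Schwarz[OF assms(1) u(1) u'(1)] by (simp add: abs_le_iff)
  also have "(- mink x z) * (- mink x z') < cosh s * cosh s"
    using c assms by (intro mult_strict_mono) auto
  also have "hnorm ?u * hnorm ?u' \<le> \<bar>sinh s\<bar> * \<bar>sinh s\<bar>"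
    using n hnorm_power2(2)[OF assms(1) u(1)] hnorm_power2(2)[OF assms(1) u'(1)]
    by (intro mult_mono) auto
  finally show ?thesis by (simp add: cosh_double power2_eq_square)
qed

text \<open>The summand 1 pays for the one candidate that may be too close to \<open>x\<close>. A
  factor \<open>sqrt (DIM('a))\<close> is lost in passing to the largest coordinate and another in
  normalising the sign vector; \<open>sinh (2 * a) = 2 * cosh a * sinh a\<close> makes up for both,
  since \<open>DIM('a) < 2 * cosh a\<close>.\<close>

lemma resisting_response:
  fixes x :: "real \<times> 'a::euclidean_space"
  assumes x: "x \<in> hyperboloid" and C: "finite C" "C \<subseteq> hyperboloid"
    and sep: "\<And>z z'. z \<in> C \<Longrightarrow> z' \<in> C \<Longrightarrow> z \<noteq> z' \<Longrightarrow> cosh (4 * a) \<le> - mink z z'"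
    and a: "a > 0" "real DIM('a) < 2 * cosh a"
  obtains g where "g \<in> tangent x" "hnorm g = 1"
    "card C \<le> 4 * card {z \<in> C. mink z g < - sinh a} + 1"
proof -
  define C1 where "C1 = {z \<in> C. cosh (2 * a) \<le> - mink x z}"
  have "card (C - C1) \<le> Suc 0"
  proof (rule card_le_Suc0_iff_eq[THEN iffD2])
    show "\<forall>z\<in>C - C1. \<forall>z'\<in>C - C1. z = z'"
    proof (intro ballI, rule ccontr)
      fix z z' assume z: "z \<in> C - C1" "z' \<in> C - C1" "z \<noteq> z'"
      have "- mink z z' < cosh (2 * (2 * a))"
        by (rule near_unique[OF x]) (use z C in \<open>auto simp: C1_def\<close>)
      thus False using sep[of z z'] z by auto
    qed
  qed (use C in simp)
  moreover have "card (C1 \<union> (C - C1)) = card C1 + card (C - C1)"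
    using C by (intro card_Un_disjoint) (auto simp: C1_def)
  moreover have "C1 \<union> (C - C1) = C" by (auto simp: C1_def)
  ultimately have C1: "card C \<le> card C1 + 1" by simp
  define n where "n = sqrt (real DIM('a))"
  have n: "n > 0" "n * n = real DIM('a)" by (simp_all add: n_def)
  define w where "w z = flat x (z + mink x z *\<^sub>R x)" for z
  define G where "G S = lift x ((1 / n) *\<^sub>R signvec S)" for S :: "'a set"
  have "\<exists>S\<in>Pow Basis. card C1 \<le> 4 * card {z \<in> C1. n * (w z \<bullet> signvec S) \<le> - norm (w z)}"
    by (rule exists_popular)
       (use C card_good_signs in \<open>auto simp: C1_def card_Pow n_def\<close>)
  then obtain S where S: "card C1 \<le> 4 * card {z \<in> C1. n * (w z \<bullet> signvec S) \<le> - norm (w z)}"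
    by blast
  have "mink z (G S) < - sinh a" if z: "z \<in> C1" "n * (w z \<bullet> signvec S) \<le> - norm (w z)" for z
  proof -
    have zH: "z \<in> hyperboloid" "- mink x z \<ge> cosh (2 * a)" using z C by (auto simp: C1_def)
    note u = hyperboloid_decompose[OF x zH(1)]
    have "(cosh (2 * a))\<^sup>2 \<le> (mink x z)\<^sup>2"
      using power_mono[OF zH(2), of 2] by simp
    hence "sinh (2 * a) \<le> norm (w z)"
      using a unfolding w_def hnorm_flat[OF x u(1), symmetric] u(2)
      by (intro real_le_rsqrt) (simp add: cosh_square_eq)
    moreover have "sinh (2 * a) = 2 * cosh a * sinh a" by (simp add: sinh_double)
    moreover have "real DIM('a) * sinh a < 2 * cosh a * sinh a"
      using a by (intro mult_strict_right_mono) auto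
    ultimately have "n * (w z \<bullet> signvec S) < n * n * (- sinh a)" using z(2) n(2) by simp
    hence "w z \<bullet> signvec S < n * (- sinh a)"
      using n(1) by (simp only: mult.assoc mult_less_cancel_left_pos)
    hence "w z \<bullet> ((1 / n) *\<^sub>R signvec S) < - sinh a"
      using n(1) by (simp add: pos_divide_less_eq mult.commute)
    moreover have "mink z (G S) = mink (z + mink x z *\<^sub>R x) (G S)"
      using lift_tangent[OF x] by (simp add: mink_simps G_def tangent_def)
    moreover have "mink (z + mink x z *\<^sub>R x) (G S) = w z \<bullet> ((1 / n) *\<^sub>R signvec S)"
      unfolding G_def mink_eq_inner_flat[OF x u(1) lift_tangent[OF x]] by (simp add: w_def flat_lift)
    ultimately show ?thesis by simp
  qed
  hence "card {z \<in> C1. n * (w z \<bullet> signvec S) \<le> - norm (w z)} \<le> card {z \<in> C. mink z (G S) < - sinh a}"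
    using C by (intro card_mono) (auto simp: C1_def)
  hence "card C \<le> 4 * card {z \<in> C. mink z (G S) < - sinh a} + 1" using S C1 by linarith
  moreover have "G S \<in> tangent x" unfolding G_def by (rule lift_tangent[OF x])
  moreover have "hnorm (G S) = 1"
    using n by (simp add: G_def hnorm_lift[OF x] norm_signvec n_def)
  ultimately show ?thesis by (intro that)
qed

text \<open>The response at step \<open>k\<close> depends on a query that depends on earlier
  responses. Building the history by recursion resolves the circularity.\<close>

lemma exists_responses:
  fixes A :: "'a::euclidean_space algorithm"
  shows "\<exists>g. \<forall>k. g k = F (query A g k)"
proof -
  define h where "h = rec_nat [] (\<lambda>_ h. h @ [(A h, F (A h))])"
  define g where "g k = F (A (h k))" for k
  have "transcript A g k = h k" for k
    by (induction k) (simp_all add: h_def g_def)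
  thus ?thesis by (intro exI[of _ g]) (simp add: query_def g_def)
qed

text \<open>An algorithm is constrained only on valid histories, so validity of the transcript and
  of the next query are proved in one induction.\<close>

lemma query_in_hyperboloid:
  assumes A: "is_algorithm A"
    and g: "\<And>k. query A g k \<in> hyperboloid \<Longrightarrow> g k \<in> tangent (query A g k) \<and> hnorm (g k) = 1"
  shows "query A g k \<in> hyperboloid"
proof -
  have "transcript A g k \<in> lists unit_tangent_bundle \<and> query A g k \<in> hyperboloid"
  proof (induction k)
    case 0
    show ?case using A by (simp add: is_algorithm_def query_def)
  next
    case (Suc k)
    have "transcript A g (Suc k) \<in> lists unit_tangent_bundle"
      using Suc g[of k] by (simp add: unit_tangent_bundle_def query_def)
    thus ?case using A by (simp add: is_algorithm_def query_def)
  qed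
  thus ?thesis ..
qed

text \<open>One of two opposite unit vectors is always legal. Legality concerns all steps, so this
  continues the game after the oracle has fixed \<open>z\<close>.\<close>

lemma exists_legal_responses:
  fixes A :: "'a::euclidean_space algorithm"
  assumes A: "is_algorithm A" and z: "z \<in> hyperboloid"
  shows "\<exists>g. legal_responses A z g"
proof -
  obtain b :: 'a where b: "b \<in> Basis" using nonempty_Basis by blast
  define F where "F x = lift x (if mink z (lift x b) \<le> 0 then b else - b)" for x
  obtain g where g: "\<And>k. g k = F (query A g k)" using exists_responses[of F A] by blast
  have F: "F x \<in> tangent x" "hnorm (F x) = 1" "mink z (F x) \<le> 0" if "x \<in> hyperboloid" for x
  proof -
    show "F x \<in> tangent x" unfolding F_def by (rule lift_tangent[OF that])
    show "hnorm (F x) = 1" using b by (simp add: F_def hnorm_lift[OF that])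
    have "lift x (- b) = - lift x b" by (simp add: lift_def)
    thus "mink z (F x) \<le> 0" by (auto simp: F_def mink_def)
  qed
  have q: "query A g k \<in> hyperboloid" for k
    by (rule query_in_hyperboloid[OF A]) (metis F(1,2) g)
  have "g k \<in> tangent (query A g k) \<and> hnorm (g k) = 1 \<and> mink z (g k) \<le> 0" for k
    using F[OF q[of k]] g[of k] by simp
  hence "legal_responses A z g"
    using mink_hlog_nonpos[OF q z] by (simp add: legal_responses_def)
  thus ?thesis by blast
qed

text \<open>Transcripts grow at the end, whereas the induction over the game removes the first
  round; this converts one view into the other.\<close>

lemma transcript_case_nat:
  "transcript A (case_nat g0 g) (Suc k)
     = (A [], g0) # transcript (\<lambda>h. A ((A [], g0) # h)) g k"
  by (induction k) simp_all

lemma query_case_nat: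
  "query A (case_nat g0 g) 0 = A []"
  "query A (case_nat g0 g) (Suc k) = query (\<lambda>h. A ((A [], g0) # h)) g k"
  by (simp_all only: query_def transcript_case_nat) simp

text \<open>
  Induction over all algorithms: after the first answer the game continues with the algorithm that
  remembers it.
\<close>

lemma resisting_oracle:
  fixes A :: "'a::euclidean_space algorithm"
  assumes "is_algorithm A" and "finite C" "C \<subseteq> hyperboloid" "4 ^ K \<le> card C"
    and "\<And>z z'. z \<in> C \<Longrightarrow> z' \<in> C \<Longrightarrow> z \<noteq> z' \<Longrightarrow> cosh (4 * a) \<le> - mink z z'"
    and a: "a > 0" "real DIM('a) < 2 * cosh a"
  shows "\<exists>z\<in>C. \<exists>g. legal_responses A z g \<and> (\<forall>k<K. mink z (g k) < - sinh a)"
  using assms(1-5)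
proof (induction K arbitrary: A C)
  case 0
  hence "C \<noteq> {}" by auto
  then obtain z where "z \<in> C" by blast
  with exists_legal_responses[OF 0(1)] 0(3) show ?case by blast
next
  case (Suc K)
  let ?x = "A []"
  have x: "?x \<in> hyperboloid" using Suc.prems(1) by (simp add: is_algorithm_def)
  obtain g0 where g0: "g0 \<in> tangent ?x" "hnorm g0 = 1"
    and card: "card C \<le> 4 * card {z \<in> C. mink z g0 < - sinh a} + 1"
    using resisting_response[OF x Suc.prems(2,3,5) a] by blast
  let ?A = "\<lambda>h. A ((?x, g0) # h)" and ?C = "{z \<in> C. mink z g0 < - sinh a}"
  have "is_algorithm ?A"
    using Suc.prems(1) x g0 by (auto simp: is_algorithm_def unit_tangent_bundle_def)
  \<comment> \<open>The extra 1 costs nothing: \<open>4 ^ Suc K \<le> 4 * card ?C + 1\<close> with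
    both \<open>4 ^ Suc K\<close> and \<open>4 * card ?C\<close> divisible by 4.\<close>
  moreover have "4 ^ K \<le> card ?C" using card Suc.prems(4) by simp
  ultimately obtain z g where z: "z \<in> ?C" "legal_responses ?A z g" "\<forall>k<K. mink z (g k) < - sinh a"
    using Suc.IH[of ?A ?C] Suc.prems(2,3,5) by auto
  have "sinh a > 0" using a by simp
  hence "mink z g0 \<le> 0" using z(1) by (simp only: mem_Collect_eq) linarith
  hence "mink (hlog ?x z) g0 \<le> 0"
    using z(1) Suc.prems(3) by (intro mink_hlog_nonpos x g0) auto
  hence "legal_responses A z (case_nat g0 g)"
    using z(2) g0 unfolding legal_responses_def
    by (auto simp: query_case_nat split: nat.split)
  moreover have "\<forall>k<Suc K. mink z (case_nat g0 g k) < - sinh a"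
    using z by (auto split: nat.split)
  ultimately show ?case using z(1) by blast
qed


section \<open>The constants\<close>

text \<open>With \<open>real d \<le> exp a\<close> and \<open>a \<le> r / 640\<close>, the left side
  of the packing condition is at most \<open>2 * exp (5 * a + r / 4)\<close>, hence at most
  \<open>2 * exp (r / 2)\<close>. The lattice has at least \<open>exp ((d - 1) * r / 8)\<close>
  points, while the required power of 4 is about \<open>exp ((d - 1) * r / 16)\<close> at most; the
  gap absorbs the rounding up.\<close>

lemma lattice_size:
  fixes d :: nat and r a :: real
  assumes d: "d \<ge> 3" and r: "r \<ge> 1280 * (real d - 1) * ln (real d)"
    and a: "a = r / (320 * (real d - 1))"
  defines "M \<equiv> nat \<lceil>exp (r / 8)\<rceil>"
  shows "real (d - 1) * (2 * (sinh (2 * a))\<^sup>2 * (real M)\<^sup>2) \<le> cosh r - 1"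
    and "4 ^ nat \<lceil>1 / 32 * (real d - 1) * r\<rceil> \<le> M ^ (d - 1)"
    and "r > 0" "a > 0" "real d < 2 * cosh a"
proof -
  have d1: "real d - 1 \<ge> 2" "real (d - 1) = real d - 1" using d by auto
  have "ln (real d) \<ge> 1"
  proof -
    have "exp 1 \<le> real d" using exp_le d by linarith
    thus ?thesis using d by (subst ln_ge_iff) auto
  qed
  hence "(real d - 1) * ln (real d) \<ge> 2 * 1" using d1 by (intro mult_mono) auto
  hence r1: "r \<ge> 2560" using r by linarith
  thus "r > 0" by simp
  show a0: "a > 0" using r1 d1 a by simp
  \<comment> \<open>The constant 4 is 1280 / 320.\<close>
  have "4 * ln (real d) \<le> a"
    using r d1 unfolding a by (subst pos_le_divide_eq) (auto simp: mult_ac)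
  hence "ln (real d) \<le> a" using \<open>ln (real d) \<ge> 1\<close> by linarith
  hence da: "real d \<le> exp a" using d by (metis exp_le_cancel_iff exp_ln of_nat_0_less_iff
        zero_less_numeral less_le_trans)
  show "real d < 2 * cosh a" using da exp_gt_zero[of "- a"] by (simp add: cosh_def del: exp_gt_zero)
  have "a \<le> r / (320 * 2)" unfolding a using d1 r1 by (intro divide_left_mono) auto
  hence ar: "a \<le> r / 640" by simp
  have "exp (r / 8) \<ge> 1" using r1 by simp
  hence "real M \<le> exp (r / 8) + 1" unfolding M_def by linarith
  hence M1: "real M \<le> 2 * exp (r / 8)" using \<open>exp (r / 8) \<ge> 1\<close> by linarith
  have M2: "real M \<ge> exp (r / 8)" unfolding M_def by linarith
  have sq: "(exp y)\<^sup>2 = exp (2 * y)" for y :: real by (simp add: exp_double)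
  have "(real M)\<^sup>2 \<le> (2 * exp (r / 8))\<^sup>2" using M1 by (intro power_mono) auto
  hence M3: "(real M)\<^sup>2 \<le> 4 * exp (r / 4)" by (simp add: power_mult_distrib sq)
  have "(sinh (2 * a))\<^sup>2 \<le> (exp (2 * a) / 2)\<^sup>2"
    using a0 by (intro power_mono) (auto simp: sinh_def)
  hence s: "(sinh (2 * a))\<^sup>2 \<le> exp (4 * a) / 4" by (simp add: power_divide sq)
  have "(sinh (2 * a))\<^sup>2 * (real M)\<^sup>2 \<le> (exp (4 * a) / 4) * (4 * exp (r / 4))"
    using s M3 by (intro mult_mono) auto
  hence "real (d - 1) * ((sinh (2 * a))\<^sup>2 * (real M)\<^sup>2)
      \<le> exp a * ((exp (4 * a) / 4) * (4 * exp (r / 4)))"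
    by (rule mult_mono[rotated]) (use da in auto)
  also have "\<dots> = exp (5 * a + r / 4)" by (simp add: exp_add[symmetric])
  also have "\<dots> \<le> exp (r / 2)" using ar r1 by simp
  finally have 1: "real (d - 1) * (2 * (sinh (2 * a))\<^sup>2 * (real M)\<^sup>2) \<le> 2 * exp (r / 2)" by simp
  have "exp (r / 2) \<ge> 1 + r / 2" by (rule exp_ge_add_one_self)
  hence "exp (r / 2) \<ge> 6" using r1 by linarith
  hence "6 * exp (r / 2) \<le> exp (r / 2) * exp (r / 2)" by (intro mult_right_mono) auto
  also have "\<dots> = exp r" by (simp flip: exp_add)
  finally have "3 * exp (r / 2) \<le> exp r / 2" by simp
  also have "\<dots> \<le> cosh r" by (simp add: cosh_def)
  finally show "real (d - 1) * (2 * (sinh (2 * a))\<^sup>2 * (real M)\<^sup>2) \<le> cosh r - 1"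
    using 1 \<open>exp (r / 2) \<ge> 6\<close> by linarith
  define K where "K = nat \<lceil>1 / 32 * (real d - 1) * r\<rceil>"
  have "1 / 32 * (real d - 1) * r \<ge> 0" using d1 r1 by simp
  hence K: "real K \<le> 1 / 32 * (real d - 1) * r + 1" unfolding K_def by linarith
  have e2: "(4::real) \<le> exp 2"
  proof -
    have "(2::real) \<le> exp 1" using exp_ge_add_one_self[of 1] by simp
    hence "2 * 2 \<le> exp 1 * exp (1::real)" by (intro mult_mono) auto
    thus ?thesis by (simp flip: exp_add)
  qed
  have "(4::real) ^ K \<le> exp 2 ^ K" using e2 by (intro power_mono) auto
  also have "\<dots> = exp (2 * real K)" by (simp add: exp_of_nat_mult mult.commute)
  also have "\<dots> \<le> exp (real (d - 1) * (r / 8))"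
  proof -
    have "(real d - 1) * r \<ge> 2 * 2560" using d1 r1 by (intro mult_mono) auto
    thus ?thesis using K d1(2) by simp
  qed
  also have "\<dots> = exp (r / 8) ^ (d - 1)" by (rule exp_of_nat_mult)
  also have "\<dots> \<le> real M ^ (d - 1)" using M2 by (intro power_mono) auto
  finally have "real (4 ^ K) \<le> real (M ^ (d - 1))" by simp
  thus "4 ^ nat \<lceil>1 / 32 * (real d - 1) * r\<rceil> \<le> M ^ (d - 1)"
    unfolding of_nat_le_iff K_def .
qed

theorem theorem15:
  fixes xref :: "real \<times> 'a::euclidean_space"
    and A :: "'a algorithm"
    and d :: nat
    and r \<epsilon> T :: real
  assumes "d = DIM('a)" and "d \<ge> 3"
    and "xref \<in> hyperboloid"
    and "r \<ge> 1280 * (real d - 1) * ln (real d)"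
    and "\<epsilon> = 1 / (320 * (real d - 1))"
    and "T = 1 / 32 * (real d - 1) * r"
    and "is_algorithm A"
  shows "\<exists>z \<in> hball xref r. \<exists>g. legal_responses A z g \<and>
           (\<forall>k::nat. real k < T \<longrightarrow>
              hdist_set z (hhyperplane (query A g k) (g k)) > \<epsilon> * r)"
proof -
  define a where "a = \<epsilon> * r"
  define M where "M = nat \<lceil>exp (r / 8)\<rceil>"
  have "a = r / (320 * (real d - 1))" by (simp add: a_def assms(5))
  note size = lattice_size[OF assms(2,4) this, folded M_def assms(6), unfolded assms(1)]
  \<comment> \<open>Taking \<open>s = 2 * a\<close> yields the separation \<open>4 * a\<close> that
    the oracle requires.\<close>
  obtain C where C: "finite C" "card C = M ^ (DIM('a) - 1)" "C \<subseteq> hball xref r"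
    "\<And>z z'. z \<in> C \<Longrightarrow> z' \<in> C \<Longrightarrow> z \<noteq> z' \<Longrightarrow> cosh (2 * (2 * a)) \<le> - mink z z'"
    using horo_packing[OF assms(3), of "2 * a" r M] size by auto
  have CH: "C \<subseteq> hyperboloid" using C(3) by (auto simp: hball_def)
  obtain z g where z: "z \<in> C" and g: "legal_responses A z g"
    and far: "\<forall>k<nat \<lceil>T\<rceil>. mink z (g k) < - sinh a"
    using resisting_oracle[OF assms(7) C(1) CH, of "nat \<lceil>T\<rceil>" a] C(2,4) size
      assms(1,6) by auto
  have gk: "g k \<in> tangent (query A g k)" "hnorm (g k) = 1" for k
    using g by (auto simp: legal_responses_def)
  have q: "query A g k \<in> hyperboloid" for k
    by (rule query_in_hyperboloid[OF assms(7)]) (use gk in simp)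
  have "hdist_set z (hhyperplane (query A g k) (g k)) > \<epsilon> * r" if "real k < T" for k
  proof -
    \<comment> \<open>Rounding \<open>T\<close> up covers every integer below \<open>T\<close>, also
      when \<open>T\<close> is not an integer.\<close>
    have "k < nat \<lceil>T\<rceil>" using that by linarith
    hence "mink z (g k) < - sinh a" using far by blast
    from hdist_set_hhyperplane_gt[OF q _ gk this] show ?thesis
      using z CH by (auto simp: a_def)
  qed
  thus ?thesis using z g C(3) by blast
qed

end
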